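(* Let $\mathcal F=\{x_j\}_{j\in J}$ be a frame of vectors of norm $1$ in a separable real Hilbert space $\mathcal H$, with analysis operator $T^*$ and synthesis operator $T$, and let $P:\mathcal H\to\mathcal H$ be an orthogonal projection. (a) $\mathcal F$ is scalable if and only if there exists $\vec c\in\ell^\infty(J)$ such that, for every $f\in\mathcal H$, $$\min_{u\in\mathcal H}\Big\{\tfrac12\|D_{\vec c}T^*u\|^2-\langle f,u\rangle\Big\}=-\tfrac12\|f\|^2 .$$ (b) $\mathcal F$ is piecewise scalable with projection $P$ if and only if there exist $\vec a,\vec b\in\ell^\infty(J)$ for which both of the following hold: (i) for every $u,w\in\mathcal H$, $\ \langle D_{\vec a}T^*Pu,\ D_{\vec b}T^*(I-P)w\rangle=0$; (ii) for every $f\in\mathcal H$, $$\min_{u\in\mathcal H}\Big\{\tfrac12\big(\|D_{\vec a}T^*Pu\|^2+\|D_{\vec b}T^*(I-P)u\|^2\big)-\langle f,u\rangle\Big\}=-\tfrac12\|f\|^2 .$$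
   Context: $J\subset\mathbb N$ is a nonempty (finite or infinite) index set; $\ell^2(J)$ and $\ell^\infty(J)$ are the spaces of square-summable, respectively bounded, real sequences indexed by $J$. A sequence of distinct vectors $\{x_j\}_{j\in J}$ in $\mathcal H$ is a frame if there are constants $A,B>0$ with $A\|x\|^2\le\sum_{j\in J}|\langle x,x_j\rangle|^2\le B\|x\|^2$ for all $x\in\mathcal H$. A family $\{y_j\}_{j\in J}$ in $\mathcal H$ (zero vectors and repetitions allowed) is a Parseval frame if $\sum_{j\in J}|\langle x,y_j\rangle|^2=\|x\|^2$ for all $x\in\mathcal H$. The synthesis operator is $T:\ell^2(J)\to\mathcal H$, $T(\vec a)=\sum_{j\in J}a_jx_j$; the analysis operator is $T^*:\mathcal H\to\ell^2(J)$, $T^*x=(\langle x,x_j\rangle)_{j\in J}$. For $\vec c\in\ell^\infty(J)$, $D_{\vec c}:\ell^2(J)\to\ell^2(J)$ is $D_{\vec c}(\vec y)=(c_jy_j)_{j\in J}$. $\mathcal F$ is scalable if there is $\vec c\in\ell^\infty(J)$ such that $\{c_jx_j\}_{j\in J}$ is a Parseval frame. $\mathcal F$ is piecewise scalable with projection $P$ if there are $\vec a,\vec b\in\ell^\infty(J)$ such that $\{a_jPx_j+b_j(I-P)x_j\}_{j\in J}$ is a Parseval frame for $\mathcal H$. *)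

theory Defs
  imports "HOL-Analysis.Analysis"
begin

text \<open>
  Sequences indexed by a set \<open>J\<close> of naturals are functions on \<^typ>\<open>nat\<close> of which only the
  values on \<open>J\<close> are ever used. A real Hilbert space is a type of sort
  \<open>{real_inner, complete_space}\<close>.
\<close>

definition l2 :: "nat set \<Rightarrow> (nat \<Rightarrow> real) set" where
  "l2 J = {y. (\<lambda>j. (y j)\<^sup>2) summable_on J}"

definition linf :: "nat set \<Rightarrow> (nat \<Rightarrow> real) set" where
  "linf J = {c. bounded (c ` J)}"

definition l2_inner :: "nat set \<Rightarrow> (nat \<Rightarrow> real) \<Rightarrow> (nat \<Rightarrow> real) \<Rightarrow> real" where
  "l2_inner J y z = (\<Sum>\<^sub>\<infinity>j\<in>J. y j * z j)"

definition l2_norm :: "nat set \<Rightarrow> (nat \<Rightarrow> real) \<Rightarrow> real" where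
  "l2_norm J y = sqrt (l2_inner J y y)"

definition is_frame :: "nat set \<Rightarrow> (nat \<Rightarrow> 'a::real_inner) \<Rightarrow> bool" where
  "is_frame J x \<longleftrightarrow> inj_on x J \<and>
     (\<exists>A>0. \<exists>B>0. \<forall>v.
        (\<lambda>j. (v \<bullet> x j)\<^sup>2) summable_on J \<and>
        A * (norm v)\<^sup>2 \<le> (\<Sum>\<^sub>\<infinity>j\<in>J. (v \<bullet> x j)\<^sup>2) \<and>
        (\<Sum>\<^sub>\<infinity>j\<in>J. (v \<bullet> x j)\<^sup>2) \<le> B * (norm v)\<^sup>2)"

text \<open>In contrast to \<^const>\<open>is_frame\<close>, repetitions are allowed here.\<close>

definition is_parseval_frame :: "nat set \<Rightarrow> (nat \<Rightarrow> 'a::real_inner) \<Rightarrow> bool" where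
  "is_parseval_frame J y \<longleftrightarrow> (\<forall>v. ((\<lambda>j. (v \<bullet> y j)\<^sup>2) has_sum (norm v)\<^sup>2) J)"

text \<open>The operator \<open>T\<^sup>*\<close> in coordinates.\<close>

definition analysis_op :: "(nat \<Rightarrow> 'a::real_inner) \<Rightarrow> 'a \<Rightarrow> nat \<Rightarrow> real" where
  "analysis_op x v = (\<lambda>j. v \<bullet> x j)"

definition diag_op :: "(nat \<Rightarrow> real) \<Rightarrow> (nat \<Rightarrow> real) \<Rightarrow> nat \<Rightarrow> real" where
  "diag_op c y = (\<lambda>j. c j * y j)"

definition orthogonal_projection :: "('a::real_inner \<Rightarrow> 'a) \<Rightarrow> bool" where
  "orthogonal_projection P \<longleftrightarrow>
     bounded_linear P \<and> P \<circ> P = P \<and> (\<forall>u v. P u \<bullet> v = u \<bullet> P v)"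

definition scalable :: "nat set \<Rightarrow> (nat \<Rightarrow> 'a::real_inner) \<Rightarrow> bool" where
  "scalable J x \<longleftrightarrow> (\<exists>c\<in>linf J. is_parseval_frame J (\<lambda>j. c j *\<^sub>R x j))"

definition piecewise_scalable ::
    "nat set \<Rightarrow> (nat \<Rightarrow> 'a::real_inner) \<Rightarrow> ('a \<Rightarrow> 'a) \<Rightarrow> bool" where
  "piecewise_scalable J x P \<longleftrightarrow>
     (\<exists>a\<in>linf J. \<exists>b\<in>linf J.
        is_parseval_frame J (\<lambda>j. a j *\<^sub>R P (x j) + b j *\<^sub>R (x j - P (x j))))"

text \<open>The minimum of \<open>\<phi>\<close> over the whole space is attained and equals \<open>m\<close>.\<close>

definition has_minimum :: "('a \<Rightarrow> real) \<Rightarrow> real \<Rightarrow> bool" where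
  "has_minimum \<phi> m \<longleftrightarrow> (\<exists>u. is_arg_min \<phi> (\<lambda>_. True) u \<and> \<phi> u = m)"

text \<open>
  The next three facts show that, for a frame and bounded scalings, all sums behind
  \<^const>\<open>l2_inner\<close> and \<^const>\<open>l2_norm\<close> converge, so the default value \<open>0\<close> of a divergent
  \<^const>\<open>infsum\<close> never arises.
\<close>

lemma analysis_op_l2: "is_frame J x \<Longrightarrow> analysis_op x v \<in> l2 J"
  by (auto simp: is_frame_def analysis_op_def l2_def)

lemma diag_op_l2:
  assumes "c \<in> linf J" "y \<in> l2 J"
  shows "diag_op c y \<in> l2 J"
proof -
  obtain M where M: "\<And>j. j \<in> J \<Longrightarrow> \<bar>c j\<bar> \<le> M"
    using assms(1) by (auto simp: linf_def bounded_iff)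
  have "(\<lambda>j. M\<^sup>2 * (y j)\<^sup>2) summable_on J"
    using assms(2) unfolding l2_def by (intro summable_on_cmult_right) simp
  moreover have "(c j * y j)\<^sup>2 \<le> M\<^sup>2 * (y j)\<^sup>2" if "j \<in> J" for j
    using power_mono[OF M[OF that], of 2] by (simp add: power_mult_distrib mult_right_mono)
  ultimately have "(\<lambda>j. (c j * y j)\<^sup>2) summable_on J"
    by (rule summable_on_comparison_test) simp_all
  then show ?thesis
    by (simp add: l2_def diag_op_def)
qed

lemma l2_inner_summable:
  assumes "y \<in> l2 J" "z \<in> l2 J"
  shows "(\<lambda>j. y j * z j) summable_on J"
proof -
  have "(\<lambda>j. norm (y j * z j)) summable_on J"
    by (rule abs_summable_product) (use assms in \<open>simp_all add: l2_def power2_eq_square\<close>)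
  then show ?thesis
    by (rule abs_summable_summable)
qed

end

theory Submission
  imports Defs
begin

text \<open>
  Both parts rest on one fact about convex functions: half the squared norm is its own Legendre
  transform, and it is the only function \<open>q / 2\<close> for which the infimum of \<open>q u / 2 - f \<bullet> u\<close> is
  attained with value \<open>- (norm f)\<^sup>2 / 2\<close> for every \<open>f\<close> (lemma \<open>half_norm_squared_minimum_iff\<close>).
  So each variational condition says just that a certain sum of squares equals \<open>(norm u)\<^sup>2\<close> for
  all \<open>u\<close>.

  For scalability this sum of squares is that of the coefficients of \<open>u\<close> against
  \<open>c j *\<^sub>R x j\<close>, so the condition is the Parseval identity.

  For piecewise scalability, self-adjointness of \<open>P\<close> splits the coefficient sequence of \<open>u\<close> against
  \<open>a j *\<^sub>R P (x j) + b j *\<^sub>R (x j - P (x j))\<close> into a part depending on \<open>P u\<close> and a part depending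
  on \<open>u - P u\<close>. The squared norm of the sum of the two parts is the sum of their squared norms plus
  twice their inner product. Condition (i) makes this mixed term vanish, and (ii) is then again the
  Parseval identity. Conversely, a Parseval identity forces (i): applied to \<open>P u\<close>, to
  \<open>w - P w\<close> and to the sum of these two orthogonal vectors, it shows that the Pythagorean identity
  for the vectors carries over to their coefficient sequences, which leaves nothing for the mixed
  term (lemma \<open>parseval_piecewise_iff\<close>).
\<close>

text \<open>
  If \<open>q u = (norm u)\<^sup>2\<close>, completing the square exhibits \<open>u = f\<close> as the minimiser. Conversely, the
  lower bound at \<open>f = u\<close> gives \<open>q u \<ge> (norm u)\<^sup>2\<close>. Given that inequality, a point
  \<open>u\<close> at which the value \<open>- (norm f)\<^sup>2 / 2\<close> is attained satisfies \<open>(norm (u - f))\<^sup>2 \<le> 0\<close>, so the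
  minimiser for \<open>f\<close> is \<open>f\<close> itself, and attainment there reads \<open>q f = (norm f)\<^sup>2\<close>.
\<close>

lemma half_norm_squared_minimum_iff:
  fixes q :: "'a::real_inner \<Rightarrow> real"
  shows "(\<forall>f. has_minimum (\<lambda>u. 1/2 * q u - f \<bullet> u) (- 1/2 * (norm f)\<^sup>2))
           \<longleftrightarrow> (\<forall>u. q u = (norm u)\<^sup>2)"
proof
  assume min: "\<forall>f. has_minimum (\<lambda>u. 1/2 * q u - f \<bullet> u) (- 1/2 * (norm f)\<^sup>2)"
  have bound: "1/2 * q v - f \<bullet> v \<ge> - 1/2 * (norm f)\<^sup>2" for f v
    using min[rule_format, of f]
    by (auto simp: has_minimum_def is_arg_min_linorder)
  have lower: "(norm v)\<^sup>2 \<le> q v" for v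
    using bound[of v v] by (simp add: power2_norm_eq_inner)
  show "\<forall>u. q u = (norm u)\<^sup>2"
  proof
    fix f
    obtain u where u: "1/2 * q u - f \<bullet> u = - 1/2 * (norm f)\<^sup>2"
      using min[rule_format, of f] by (auto simp: has_minimum_def)
    have "(norm (u - f))\<^sup>2 = (norm u)\<^sup>2 - 2 * (f \<bullet> u) + (norm f)\<^sup>2"
      by (simp add: power2_norm_eq_inner inner_diff inner_commute)
    also have "\<dots> \<le> 0"
      using u lower[of u] by simp
    finally have "u = f"
      by simp
    with u show "q f = (norm f)\<^sup>2"
      by (simp add: power2_norm_eq_inner)
  qed
next
  assume q: "\<forall>u. q u = (norm u)\<^sup>2"
  show "\<forall>f. has_minimum (\<lambda>u. 1/2 * q u - f \<bullet> u) (- 1/2 * (norm f)\<^sup>2)"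
  proof
    fix f
    have square: "1/2 * q u - f \<bullet> u = 1/2 * (norm (u - f))\<^sup>2 - 1/2 * (norm f)\<^sup>2" for u
      by (simp add: q power2_norm_eq_inner inner_diff inner_commute field_simps)
    show "has_minimum (\<lambda>u. 1/2 * q u - f \<bullet> u) (- 1/2 * (norm f)\<^sup>2)"
      unfolding has_minimum_def is_arg_min_linorder square by (intro exI[of _ f]) simp
  qed
qed

lemma l2_norm_squared: "(l2_norm J y)\<^sup>2 = l2_inner J y y"
  by (simp add: l2_norm_def l2_inner_def infsum_nonneg)

lemma l2_add:
  assumes y: "y \<in> l2 J" and z: "z \<in> l2 J"
  shows "(\<lambda>j. y j + z j) \<in> l2 J"
proof -
  have "(\<lambda>j. (y j)\<^sup>2 + 2 * (y j * z j) + (z j)\<^sup>2) summable_on J"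
    using y z l2_inner_summable[OF y z]
    by (intro summable_on_add summable_on_cmult_right) (simp_all add: l2_def)
  then show ?thesis
    by (simp add: l2_def power2_sum algebra_simps)
qed

lemma l2_norm_add_squared:
  assumes y: "y \<in> l2 J" and z: "z \<in> l2 J"
  shows "(l2_norm J (\<lambda>j. y j + z j))\<^sup>2
           = (l2_norm J y)\<^sup>2 + 2 * l2_inner J y z + (l2_norm J z)\<^sup>2"
proof -
  note s = l2_inner_summable[OF y y] l2_inner_summable[OF y z] l2_inner_summable[OF z z]
  have "(l2_norm J (\<lambda>j. y j + z j))\<^sup>2
          = (\<Sum>\<^sub>\<infinity>j\<in>J. (y j * y j + 2 * (y j * z j)) + z j * z j)"
    by (simp add: l2_norm_squared l2_inner_def algebra_simps)
  also have "\<dots> = (\<Sum>\<^sub>\<infinity>j\<in>J. y j * y j) + 2 * (\<Sum>\<^sub>\<infinity>j\<in>J. y j * z j) + (\<Sum>\<^sub>\<infinity>j\<in>J. z j * z j)"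
    using s by (simp add: infsum_add infsum_cmult_right summable_on_add summable_on_cmult_right)
  finally show ?thesis
    by (simp add: l2_norm_squared l2_inner_def)
qed

lemma is_parseval_frame_iff_isometric:
  assumes "\<And>v. analysis_op y v \<in> l2 J"
  shows "is_parseval_frame J y \<longleftrightarrow> (\<forall>v. (l2_norm J (analysis_op y v))\<^sup>2 = (norm v)\<^sup>2)"
  using assms
  by (auto simp: is_parseval_frame_def l2_norm_squared l2_inner_def analysis_op_def l2_def
      power2_eq_square[symmetric] has_sum_iff)

lemma analysis_op_scaleR: "analysis_op (\<lambda>j. c j *\<^sub>R x j) v = diag_op c (analysis_op x v)"
  by (simp add: analysis_op_def diag_op_def)

text \<open>Self-adjointness moves \<open>P\<close> and \<open>I - P\<close> from the frame vectors onto the argument \<open>v\<close>.\<close>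

lemma analysis_op_piecewise:
  assumes "orthogonal_projection P"
  shows "analysis_op (\<lambda>j. a j *\<^sub>R P (x j) + b j *\<^sub>R (x j - P (x j))) v
           = (\<lambda>j. diag_op a (analysis_op x (P v)) j + diag_op b (analysis_op x (v - P v)) j)"
proof -
  have "v \<bullet> P z = P v \<bullet> z" for z
    using assms by (simp add: orthogonal_projection_def)
  then show ?thesis
    by (simp add: analysis_op_def diag_op_def inner_add_right inner_diff)
qed

lemma orthogonal_projection_apply:
  assumes "orthogonal_projection P"
  shows "P (P u) = P u" "P (u - v) = P u - P v" "P (u + v) = P u + P v"
    and "P u \<bullet> (w - P w) = 0"
proof -
  have lin: "linear P" and idem: "\<And>u. P (P u) = P u" and adj: "\<And>u v. P u \<bullet> v = u \<bullet> P v"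
    using assms by (auto simp: orthogonal_projection_def bounded_linear.linear fun_eq_iff)
  show diff: "P (u - v) = P u - P v" for u v
    by (rule linear_diff[OF lin])
  show "P (P u) = P u" "P (u + v) = P u + P v"
    by (auto simp: idem linear_add[OF lin])
  show "P u \<bullet> (w - P w) = 0"
    by (simp add: adj diff idem)
qed

text \<open>
  The forward direction recovers the mixed inner product by polarisation: \<open>P\<close> maps
  \<open>P u + (w - P w)\<close> to \<open>P u\<close>, so that the two coefficient sequences in the Parseval identity can be
  prescribed independently of each other.
\<close>

lemma parseval_piecewise_iff:
  fixes x :: "nat \<Rightarrow> 'a::real_inner"
  assumes frame: "is_frame J x" and P: "orthogonal_projection P"
    and a: "a \<in> linf J" and b: "b \<in> linf J"
  defines "S \<equiv> \<lambda>v. diag_op a (analysis_op x v)" and "R \<equiv> \<lambda>v. diag_op b (analysis_op x v)"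
  shows "is_parseval_frame J (\<lambda>j. a j *\<^sub>R P (x j) + b j *\<^sub>R (x j - P (x j))) \<longleftrightarrow>
           (\<forall>u w. l2_inner J (S (P u)) (R (w - P w)) = 0) \<and>
           (\<forall>u. (l2_norm J (S (P u)))\<^sup>2 + (l2_norm J (R (u - P u)))\<^sup>2 = (norm u)\<^sup>2)"
    (is "?parseval \<longleftrightarrow> ?orth \<and> ?isom")
proof -
  note P_simps = orthogonal_projection_apply[OF P]
  have S: "S v \<in> l2 J" and R: "R v \<in> l2 J" for v
    unfolding S_def R_def using frame a b by (simp_all add: diag_op_l2 analysis_op_l2)
  have S0: "l2_norm J (S 0) = 0" "l2_inner J (S 0) z = 0" for z
    by (simp_all add: S_def diag_op_def analysis_op_def l2_norm_def l2_inner_def)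
  have R0: "l2_norm J (R 0) = 0" "l2_inner J z (R 0) = 0" for z
    by (simp_all add: R_def diag_op_def analysis_op_def l2_norm_def l2_inner_def)
  have coeffs: "analysis_op (\<lambda>j. a j *\<^sub>R P (x j) + b j *\<^sub>R (x j - P (x j))) v
                  = (\<lambda>j. S (P v) j + R (v - P v) j)" for v
    unfolding S_def R_def by (rule analysis_op_piecewise[OF P])
  have parseval: "?parseval \<longleftrightarrow>
      (\<forall>v. (l2_norm J (S (P v)))\<^sup>2 + 2 * l2_inner J (S (P v)) (R (v - P v))
             + (l2_norm J (R (v - P v)))\<^sup>2 = (norm v)\<^sup>2)"
    by (subst is_parseval_frame_iff_isometric)
      (simp_all add: coeffs l2_add l2_norm_add_squared S R)
  show ?thesis
  proof
    assume ?parseval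
    with parseval have full:
      "(l2_norm J (S (P v)))\<^sup>2 + 2 * l2_inner J (S (P v)) (R (v - P v))
         + (l2_norm J (R (v - P v)))\<^sup>2 = (norm v)\<^sup>2" for v
      by blast
    have orth: "l2_inner J (S (P u)) (R (w - P w)) = 0" for u w
    proof -
      have "(l2_norm J (S (P u)))\<^sup>2 = (norm (P u))\<^sup>2"
        using full[of "P u"] by (simp add: P_simps R0)
      moreover have "(l2_norm J (R (w - P w)))\<^sup>2 = (norm (w - P w))\<^sup>2"
        using full[of "w - P w"] by (simp add: P_simps S0)
      moreover have "(l2_norm J (S (P u)))\<^sup>2 + 2 * l2_inner J (S (P u)) (R (w - P w))
          + (l2_norm J (R (w - P w)))\<^sup>2 = (norm (P u + (w - P w)))\<^sup>2"
        using full[of "P u + (w - P w)"] by (simp add: P_simps)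
      moreover have "(norm (P u + (w - P w)))\<^sup>2 = (norm (P u))\<^sup>2 + (norm (w - P w))\<^sup>2"
        by (rule norm_add_Pythagorean) (simp add: orthogonal_def P_simps)
      ultimately show ?thesis
        by simp
    qed
    moreover have ?isom
      using full by (simp add: orth)
    ultimately show "?orth \<and> ?isom"
      by blast
  next
    assume "?orth \<and> ?isom"
    then show ?parseval
      by (simp add: parseval)
  qed
qed

theorem corollary3p2:
  fixes J :: "nat set"
    and x :: "nat \<Rightarrow> 'a::{real_inner, complete_space}"
    and P :: "'a \<Rightarrow> 'a"
  assumes "separable_space (euclidean :: 'a topology)"
    and "J \<noteq> {}"
    and "is_frame J x"
    and "\<forall>j\<in>J. norm (x j) = 1"
    and "orthogonal_projection P"
  shows
    "(scalable J x \<longleftrightarrow>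
       (\<exists>c\<in>linf J. \<forall>f.
          has_minimum
            (\<lambda>u. 1/2 * (l2_norm J (diag_op c (analysis_op x u)))\<^sup>2 - f \<bullet> u)
            (- 1/2 * (norm f)\<^sup>2)))
     \<and>
     (piecewise_scalable J x P \<longleftrightarrow>
       (\<exists>a\<in>linf J. \<exists>b\<in>linf J.
          (\<forall>u w. l2_inner J (diag_op a (analysis_op x (P u)))
                            (diag_op b (analysis_op x (w - P w))) = 0)
          \<and>
          (\<forall>f. has_minimum
            (\<lambda>u. 1/2 * ((l2_norm J (diag_op a (analysis_op x (P u))))\<^sup>2
                        + (l2_norm J (diag_op b (analysis_op x (u - P u))))\<^sup>2) - f \<bullet> u)
            (- 1/2 * (norm f)\<^sup>2))))"
proof
  have "is_parseval_frame J (\<lambda>j. c j *\<^sub>R x j) \<longleftrightarrow>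
      (\<forall>f. has_minimum
         (\<lambda>u. 1/2 * (l2_norm J (diag_op c (analysis_op x u)))\<^sup>2 - f \<bullet> u) (- 1/2 * (norm f)\<^sup>2))"
    if c: "c \<in> linf J" for c
  proof -
    have "analysis_op (\<lambda>j. c j *\<^sub>R x j) v \<in> l2 J" for v
      unfolding analysis_op_scaleR using c assms(3) by (intro diag_op_l2 analysis_op_l2)
    then show ?thesis
      unfolding half_norm_squared_minimum_iff
      by (subst is_parseval_frame_iff_isometric) (simp_all add: analysis_op_scaleR)
  qed
  then show "scalable J x \<longleftrightarrow>
      (\<exists>c\<in>linf J. \<forall>f. has_minimum
         (\<lambda>u. 1/2 * (l2_norm J (diag_op c (analysis_op x u)))\<^sup>2 - f \<bullet> u) (- 1/2 * (norm f)\<^sup>2))"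
    unfolding scalable_def by (intro bex_cong refl)
next
  show "piecewise_scalable J x P \<longleftrightarrow>
      (\<exists>a\<in>linf J. \<exists>b\<in>linf J.
         (\<forall>u w. l2_inner J (diag_op a (analysis_op x (P u)))
                           (diag_op b (analysis_op x (w - P w))) = 0)
         \<and>
         (\<forall>f. has_minimum
            (\<lambda>u. 1/2 * ((l2_norm J (diag_op a (analysis_op x (P u))))\<^sup>2
                        + (l2_norm J (diag_op b (analysis_op x (u - P u))))\<^sup>2) - f \<bullet> u)
            (- 1/2 * (norm f)\<^sup>2)))"
    unfolding piecewise_scalable_def half_norm_squared_minimum_iff
    by (intro bex_cong refl parseval_piecewise_iff assms)
qed

end
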